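(* A sequence $\mathbf b=(b_1,\dots,b_{k-1})$ of non-negative integers is admissible if and only if it is a matching sequence.
   Context: Fix an integer $k\ge 2$. For a sequence $\mathbf b=(b_1,\dots,b_{k-1})$ of non-negative integers write $|\mathbf b|=\sum_i b_i$. The bipartite graph $\mathcal B_{\mathbf b}$ has upper vertex class $U=\{(j,l):1\le j\le l\le k-1\}$ and lower vertex class $D_{\mathbf b}=\{(i,t):1\le i\le k-1,\ 1\le t\le b_i\}$, with an edge between $(j,l)\in U$ and $(i,t)\in D_{\mathbf b}$ if and only if $j\le i\le l$. The sequence $\mathbf b$ is a matching sequence if $\mathcal B_{\mathbf b}$ has a matching covering all of $D_{\mathbf b}$. The sequence $\mathbf b$ is admissible if for every choice of pairwise distinct integers $a_1,\dots,a_k$ and every choice of finite sets $M_1,\dots,M_{k-1}\subset\mathbb Z$ with $|M_i|=b_i$, there is a permutation $\pi\in S_k$ with $\sum_{j=1}^i a_{\pi(j)}\notin M_i$ for all $1\le i\le k-1$. *)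

theory Defs
  imports "HOL-Combinatorics.Permutations"
begin

(* Sequence b = (b_1,...,b_{k-1}) represented as b :: nat => nat; only b 1..b (k-1) matter. *)

definition upper_class :: "nat \<Rightarrow> (nat \<times> nat) set" where
  "upper_class k = {(j, l). 1 \<le> j \<and> j \<le> l \<and> l \<le> k - 1}"

definition lower_class :: "nat \<Rightarrow> (nat \<Rightarrow> nat) \<Rightarrow> (nat \<times> nat) set" where
  "lower_class k b = {(i, t). 1 \<le> i \<and> i \<le> k - 1 \<and> 1 \<le> t \<and> t \<le> b i}"

definition B_edge :: "nat \<times> nat \<Rightarrow> nat \<times> nat \<Rightarrow> bool" where
  "B_edge u d \<longleftrightarrow> fst u \<le> fst d \<and> fst d \<le> snd u"

definition matching_sequence :: "nat \<Rightarrow> (nat \<Rightarrow> nat) \<Rightarrow> bool" where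
  "matching_sequence k b \<longleftrightarrow>
     (\<exists>f. inj_on f (lower_class k b) \<and>
          (\<forall>d \<in> lower_class k b. f d \<in> upper_class k \<and> B_edge (f d) d))"

definition admissible :: "nat \<Rightarrow> (nat \<Rightarrow> nat) \<Rightarrow> bool" where
  "admissible k b \<longleftrightarrow>
     (\<forall>(a :: nat \<Rightarrow> int) (M :: nat \<Rightarrow> int set).
        inj_on a {1..k} \<longrightarrow>
        (\<forall>i \<in> {1..k-1}. finite (M i) \<and> card (M i) = b i) \<longrightarrow>
        (\<exists>\<pi>. \<pi> permutes {1..k} \<and>
              (\<forall>i \<in> {1..k-1}. (\<Sum>j = 1..i. a (\<pi> j)) \<notin> M i)))"

end

theory Submission
  imports Defs "HOL-Computational_Algebra.Polynomial" "HOL-Library.FuncSet"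
begin

text \<open>
  If \<open>b\<close> is not a matching sequence, Hall's theorem gives a set \<open>S\<close> of positions such that the
  \<open>b\<^sub>i\<close> with \<open>i \<in> S\<close> sum to more than the number of intervals \<open>[j, l]\<close> meeting \<open>S\<close>. Take
  \<open>a = (1, ..., k)\<close> and let each \<open>M\<^sub>i\<close> with \<open>i \<in> S\<close> consist of the \<open>b\<^sub>i\<close> smallest values that the
  \<open>i\<close>-th partial sum could take. Every \<open>i \<in> S\<close> then pushes the partial sums up by \<open>b\<^sub>i\<close>, until the
  last one would have to exceed \<open>1 + ... + k\<close>.

  If \<open>b\<close> is a matching sequence, we may enlarge the \<open>M\<^sub>i\<close> so that each interval \<open>s\<close> is assigned one
  position \<open>pos s \<in> s\<close> and one forbidden value \<open>c s\<close> at that position. The alternating sum over \<open>\<pi>\<close>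
  of \<open>\<Prod>\<^sub>s (a\<^bsub>\<pi>(1)\<^esub> + ... + a\<^bsub>\<pi>(pos s)\<^esub> - c s)\<close> is alternating in \<open>a\<close> of degree \<open>k choose 2\<close>, hence a
  constant multiple of the Vandermonde product. Up to a positive factor that constant is obtained by
  applying \<open>\<Prod>\<^sub>s (\<partial>\<^sub>1 + ... + \<partial>\<^bsub>pos s\<^esub>)\<close> to the Vandermonde product \<open>\<Prod>\<^bsub>(j,l)\<^esub> (x\<^bsub>l+1\<^esub> - x\<^sub>j)\<close>. This gives, up to
  sign, the permanent of the incidence matrix between intervals and positions, which is positive
  because of the given matching. Derivatives are replaced by the finite differences in Ryser's
  formula for the permanent.
\<close>

subsection \<open>Non-matching sequences are not admissible\<close>

text \<open>Induction on \<open>card D\<close>. If a nonempty proper subset \<open>X\<close> is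
  tight, \<open>X\<close> is matched inside its own neighbourhood and \<open>D - X\<close> outside
  it. If none is tight, every nonempty proper subset has a neighbour to spare, so \<open>d0\<close>
  may take any \<open>u\<close> in \<open>N d0\<close>.\<close>

lemma hall_marriage:
  fixes N :: "'a \<Rightarrow> 'b set"
  assumes "finite D" and "\<And>d. d \<in> D \<Longrightarrow> finite (N d)"
    and "\<And>X. X \<subseteq> D \<Longrightarrow> card X \<le> card (\<Union>(N ` X))"
  shows "\<exists>f. inj_on f D \<and> (\<forall>d\<in>D. f d \<in> N d)"
  using assms
proof (induction "card D" arbitrary: D N rule: less_induct)
  case less
  note fin = less.prems(1) and finN = less.prems(2) and hall = less.prems(3)
  show ?case
  proof (cases "D = {}")
    case True
    then show ?thesis by simp
  next
    case False
    then obtain d0 where d0: "d0 \<in> D" by blast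
    show ?thesis
    proof (cases "\<exists>X. X \<subset> D \<and> X \<noteq> {} \<and> card (\<Union>(N ` X)) = card X")
      case True
      then obtain X where X: "X \<subset> D" "X \<noteq> {}" "card (\<Union>(N ` X)) = card X" by blast
      have finX: "finite X" using X(1) fin by (meson finite_subset psubset_imp_subset)
      define N' where "N' d = N d - \<Union>(N ` X)" for d
      have "\<exists>f. inj_on f X \<and> (\<forall>d\<in>X. f d \<in> N d)"
      proof (rule less.hyps)
        show "card X < card D" using X(1) fin by (rule psubset_card_mono[rotated])
      qed (use X(1) fin finN hall finX in auto)
      then obtain f where f: "inj_on f X" "\<forall>d\<in>X. f d \<in> N d" by blast
      have "\<exists>f. inj_on f (D - X) \<and> (\<forall>d\<in>D - X. f d \<in> N' d)"
      proof (rule less.hyps)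
        show "card (D - X) < card D"
          using X fin by (intro psubset_card_mono) auto
        show "finite (D - X)" using fin by simp
        show "finite (N' d)" if "d \<in> D - X" for d using that finN by (simp add: N'_def)
        fix Y assume Y: "Y \<subseteq> D - X"
        have finY: "finite Y" using Y fin by (meson finite_Diff finite_subset)
        have "card X + card Y = card (X \<union> Y)"
          using Y finX finY by (subst card_Un_disjoint) auto
        also have "\<dots> \<le> card (\<Union>(N ` (X \<union> Y)))"
          using X Y by (intro hall) auto
        also have "\<Union>(N ` (X \<union> Y)) = \<Union>(N ` X) \<union> \<Union>(N' ` Y)" by (auto simp: N'_def)
        also have "card \<dots> \<le> card (\<Union>(N ` X)) + card (\<Union>(N' ` Y))" by (rule card_Un_le)
        finally show "card Y \<le> card (\<Union>(N' ` Y))" using X(3) by simp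
      qed
      then obtain g where g: "inj_on g (D - X)" "\<forall>d\<in>D - X. g d \<in> N' d" by blast
      define h where "h d = (if d \<in> X then f d else g d)" for d
      have "inj_on h D"
      proof (rule inj_onI)
        fix x y assume xy: "x \<in> D" "y \<in> D" "h x = h y"
        have sep: "f u \<noteq> g v" if "u \<in> X" "v \<in> D - X" for u v
          using f(2) g(2) that by (auto simp: N'_def)
        show "x = y"
          using xy sep[of x y] sep[of y x] inj_onD[OF f(1), of x y] inj_onD[OF g(1), of x y]
          by (auto simp: h_def split: if_splits)
      qed
      moreover have "\<forall>d\<in>D. h d \<in> N d" using f g by (auto simp: h_def N'_def)
      ultimately show ?thesis by blast
    next
      case False
      have "card {d0} \<le> card (\<Union>(N ` {d0}))" using d0 by (intro hall) auto
      then have "N d0 \<noteq> {}" by auto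
      then obtain u where u: "u \<in> N d0" by blast
      define N' where "N' d = N d - {u}" for d
      have "\<exists>f. inj_on f (D - {d0}) \<and> (\<forall>d\<in>D - {d0}. f d \<in> N' d)"
      proof (rule less.hyps)
        show "card (D - {d0}) < card D" using d0 fin by (rule card_Diff1_less[rotated])
        show "finite (D - {d0})" using fin by simp
        show "finite (N' d)" if "d \<in> D - {d0}" for d using that finN by (simp add: N'_def)
        fix Y assume Y: "Y \<subseteq> D - {d0}"
        show "card Y \<le> card (\<Union>(N' ` Y))"
        proof (cases "Y = {}")
          case ne: False
          have "Y \<subset> D" using Y d0 by auto
          then have "card Y < card (\<Union>(N ` Y))"
            using hall[of Y] False ne by (metis nat_less_le psubset_imp_subset)
          moreover have "\<Union>(N' ` Y) = \<Union>(N ` Y) - {u}" by (auto simp: N'_def)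
          ultimately show ?thesis by (auto simp: card_Diff_singleton_if)
        qed simp
      qed
      then obtain g where g: "inj_on g (D - {d0})" "\<forall>d\<in>D - {d0}. g d \<in> N' d" by blast
      have "inj_on (g(d0 := u)) D"
        using g by (auto simp: inj_on_def N'_def)
      moreover have "\<forall>d\<in>D. (g(d0 := u)) d \<in> N d" using g u by (auto simp: N'_def)
      ultimately show ?thesis by blast
    qed
  qed
qed

lemma sum_lessThan_card_le:
  fixes A :: "nat set"
  assumes "finite A"
  shows "\<Sum>{..<card A} \<le> \<Sum>A"
  using assms
proof (induction "card A" arbitrary: A)
  case (Suc n)
  have "\<not> A \<subseteq> {..<n}"
    using card_mono[of "{..<n}" A] unfolding Suc.hyps(2)[symmetric] by auto
  then obtain x where x: "x \<in> A" "n \<le> x" by (meson lessThan_iff not_less subsetI)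
  have c: "card (A - {x}) = n" using Suc.prems x unfolding card_Diff_singleton[OF x(1)] Suc.hyps(2)[symmetric] by simp
  then have "\<Sum>{..<n} \<le> \<Sum>(A - {x})" using Suc.hyps(1)[OF c[symmetric]] Suc.prems by simp
  moreover have "\<Sum>A = x + \<Sum>(A - {x})" using sum.remove[OF Suc.prems x(1)] .
  ultimately show ?case using x unfolding Suc.hyps(2)[symmetric] by simp
qed simp

text \<open>With \<open>n = card A\<close>, a set other than \<open>{..<n}\<close> has an element of
  size at least \<open>n\<close>, while its other \<open>n - 1\<close> elements already sum to at
  least \<open>0 + ... + (n - 2)\<close>.\<close>

lemma eq_lessThan_card_if_sum_le:
  fixes A :: "nat set"
  assumes "finite A" and "\<Sum>A \<le> \<Sum>{..<card A}"
  shows "A = {..<card A}"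
proof (rule ccontr)
  assume ne: "A \<noteq> {..<card A}"
  define n where "n = card A"
  have "\<not> A \<subseteq> {..<n}"
    using card_subset_eq[of "{..<n}" A] ne unfolding n_def by auto
  then obtain x where x: "x \<in> A" "n \<le> x" by (meson lessThan_iff not_less subsetI)
  have "n \<noteq> 0" using x assms(1) by (auto simp: n_def)
  then obtain m where m: "n = Suc m" by (cases n) auto
  have "card (A - {x}) = m" using x assms m by (simp add: n_def)
  then have "\<Sum>{..<m} \<le> \<Sum>(A - {x})"
    using sum_lessThan_card_le[of "A - {x}"] assms by simp
  moreover have "\<Sum>A = x + \<Sum>(A - {x})" using sum.remove[OF assms(1) x(1)] .
  moreover have "\<Sum>{..<card A} = \<Sum>{..<m} + m" unfolding n_def[symmetric] m by simp
  ultimately show False using assms(2) x m by linarith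
qed

lemma finite_upper_class [simp]: "finite (upper_class k)"
  by (rule finite_subset[of _ "{1..k} \<times> {1..k}"]) (auto simp: upper_class_def)

lemma finite_lower_class [simp]: "finite (lower_class k b)"
proof -
  have "lower_class k b = (SIGMA i:{1..k-1}. {1..b i})" by (auto simp: lower_class_def)
  then show ?thesis by simp
qed

text \<open>The neighbourhood of \<open>(i, t)\<close> does not depend on \<open>t\<close>. Adding
  all copies of the positions occurring in a Hall violator \<open>X\<close> thus keeps its
  neighbourhood and raises its size to the sum of \<open>b\<close> over \<open>S\<close>.\<close>

lemma not_matching_sequence_obtains:
  assumes "\<not> matching_sequence k b"
  obtains S where "S \<subseteq> {1..k-1}"
    and "card {u \<in> upper_class k. \<exists>i\<in>S. fst u \<le> i \<and> i \<le> snd u} < (\<Sum>i\<in>S. b i)"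
proof -
  define N where "N d = {u \<in> upper_class k. B_edge u d}" for d
  have "\<exists>X \<subseteq> lower_class k b. \<not> card X \<le> card (\<Union>(N ` X))"
  proof (rule ccontr)
    assume "\<not> ?thesis"
    then have "\<exists>f. inj_on f (lower_class k b) \<and> (\<forall>d\<in>lower_class k b. f d \<in> N d)"
      by (intro hall_marriage) (auto simp: N_def)
    then show False using assms by (auto simp: matching_sequence_def N_def)
  qed
  then obtain X where X: "X \<subseteq> lower_class k b" "card (\<Union>(N ` X)) < card X" by (meson not_le)
  define S where "S = fst ` X"
  have S: "S \<subseteq> {1..k-1}" using X by (auto simp: S_def lower_class_def)
  have "\<Union>(N ` X) = {u \<in> upper_class k. \<exists>i\<in>S. fst u \<le> i \<and> i \<le> snd u}"
    unfolding N_def S_def B_edge_def by blast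
  moreover have "card X \<le> (\<Sum>i\<in>S. b i)"
  proof -
    have fS: "finite S" using S by (rule finite_subset) simp
    have "X \<subseteq> (SIGMA i:S. {1..b i})" 
    proof
      fix d assume "d \<in> X"
      then have "d \<in> lower_class k b" "fst d \<in> S" using X by (auto simp: S_def)
      then show "d \<in> (SIGMA i:S. {1..b i})" by (auto simp: lower_class_def)
    qed
    then have "card X \<le> card (SIGMA i:S. {1..b i})" using fS by (intro card_mono) auto
    also have "\<dots> = (\<Sum>i\<in>S. b i)" using fS by simp
    finally show ?thesis .
  qed
  ultimately show thesis using X S that by simp
qed

section \<open>Intervals meeting a set of positions\<close>

text \<open>The default 0 stands for the empty partial sum. For a set \<open>S\<close> of positive
  positions, \<open>prev S j\<close> is also the number of intervals with right end
  \<open>j - 1\<close> that meet \<open>S\<close>.\<close>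

definition prev :: "nat set \<Rightarrow> nat \<Rightarrow> nat" where
  "prev S j = Max (insert 0 {s \<in> S. s < j})"

lemma prev_cases: "prev S j = 0 \<or> prev S j \<in> S \<and> prev S j < j"
proof -
  have "prev S j \<in> insert 0 {s \<in> S. s < j}"
    unfolding prev_def by (rule Max_in) auto
  then show ?thesis by auto
qed

lemma le_prev: "s \<in> S \<Longrightarrow> s < j \<Longrightarrow> s \<le> prev S j"
  unfolding prev_def by (rule Max_ge) auto

lemma prev_eqI:
  assumes "q = 0 \<or> q \<in> S" and "\<And>s. s \<in> S \<Longrightarrow> s < i \<Longrightarrow> s \<le> q" and "q < j" and "j \<le> i"
  shows "prev S j = q"
  unfolding prev_def by (rule Max_eqI) (use assms in auto)

text \<open>If \<open>1 \<le> x \<le> prev S j\<close>, the interval \<open>(x, j - 1)\<close>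
  contains \<open>prev S j\<close>, an element of \<open>S\<close>; different pairs
  \<open>(j, x)\<close> give different intervals.\<close>

lemma sum_prev_le_card_hit:
  "(\<Sum>j=1..k. prev S j) \<le> card {u \<in> upper_class k. \<exists>i\<in>S. fst u \<le> i \<and> i \<le> snd u}"
proof -
  define T where "T = (SIGMA j:{1..k}. {1..prev S j})"
  have "inj_on (\<lambda>(j, x). (x, j - 1)) T" by (auto simp: T_def inj_on_def)
  then have "(\<Sum>j=1..k. prev S j) = card ((\<lambda>(j, x). (x, j - 1)) ` T)"
    by (simp add: card_image T_def)
  also have "\<dots> \<le> card {u \<in> upper_class k. \<exists>i\<in>S. fst u \<le> i \<and> i \<le> snd u}"
  proof (rule card_mono)
    show "(\<lambda>(j, x). (x, j - 1)) ` T \<subseteq> {u \<in> upper_class k. \<exists>i\<in>S. fst u \<le> i \<and> i \<le> snd u}"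
    proof (clarsimp simp: T_def upper_class_def)
      fix j x assume *: "Suc 0 \<le> j" "j \<le> k" "Suc 0 \<le> x" "x \<le> prev S j"
      then show "x \<le> j - Suc 0 \<and> j - Suc 0 \<le> k - Suc 0 \<and> (\<exists>i\<in>S. x \<le> i \<and> i \<le> j - Suc 0)"
        using prev_cases[of S j] by (auto intro!: bexI[of _ "prev S j"])
    qed
  qed simp
  finally show ?thesis .
qed

text \<open>The left side is \<open>1 + 2 + ... + (i - q)\<close>. Subtracting 1 from every value
  leaves distinct naturals, whose sum is at least \<open>0 + 1 + ... + (i - q - 1)\<close>.\<close>

lemma sum_inj_on_block_ge:
  fixes f :: "nat \<Rightarrow> nat"
  assumes "inj_on f {q<..i}" and "\<And>j. j \<in> {q<..i} \<Longrightarrow> 0 < f j"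
  shows "(\<Sum>j\<in>{q<..i}. j - q) \<le> (\<Sum>j\<in>{q<..i}. f j)"
proof -
  define g where "g j = f j - 1" for j
  have inj: "inj_on g {q<..i}"
  proof (rule inj_onI)
    fix x y assume xy: "x \<in> {q<..i}" "y \<in> {q<..i}" "g x = g y"
    then have "f x = f y" using assms(2)[of x] assms(2)[of y] by (simp add: g_def)
    then show "x = y" using xy inj_onD[OF assms(1)] by blast
  qed
  have "(\<Sum>j\<in>{q<..i}. j - q - 1) = \<Sum>{..<i - q}"
    by (rule sum.reindex_bij_witness[of _ "\<lambda>m. m + q + 1" "\<lambda>j. j - q - 1"]) auto
  also have "\<dots> \<le> \<Sum>(g ` {q<..i})"
    using sum_lessThan_card_le[of "g ` {q<..i}"] inj by (simp add: card_image)
  also have "\<dots> = (\<Sum>j\<in>{q<..i}. g j)" using inj by (simp add: sum.reindex)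
  finally have "(\<Sum>j\<in>{q<..i}. (j - q - 1) + 1) \<le> (\<Sum>j\<in>{q<..i}. g j + 1)"
    unfolding sum.distrib by simp
  also have "(\<Sum>j\<in>{q<..i}. (j - q - 1) + 1) = (\<Sum>j\<in>{q<..i}. j - q)"
    by (intro sum.cong) auto
  also have "(\<Sum>j\<in>{q<..i}. g j + 1) = (\<Sum>j\<in>{q<..i}. f j)"
    using assms by (intro sum.cong) (auto simp: g_def Suc_leI)
  finally show ?thesis .
qed

lemma admissible_imp_matching_sequence:
  assumes "admissible k b"
  shows "matching_sequence k b"
proof (rule ccontr)
  assume "\<not> matching_sequence k b"
  then obtain S where S: "S \<subseteq> {1..k-1}"
    and viol: "card {u \<in> upper_class k. \<exists>i\<in>S. fst u \<le> i \<and> i \<le> snd u} < (\<Sum>i\<in>S. b i)"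
    by (rule not_matching_sequence_obtains)
  have finS: "finite S" using S by (rule finite_subset) simp
  \<comment> \<open>\<open>W i\<close> is the least value the \<open>i\<close>-th partial sum can take once \<open>M s\<close> is avoided for all \<open>s < i\<close>
    in \<open>S\<close>: the entries of a block of positions between consecutive elements of \<open>S\<close> are distinct
    and positive, so they sum to at least \<open>1 + 2 + ...\<close>.\<close>
  define W where "W i = (\<Sum>s | s \<in> S \<and> s < i. b s) + (\<Sum>j=1..i. j - prev S j)" for i
  \<comment> \<open>For \<open>i\<close> in \<open>S\<close> the window starts at the lower bound
    \<open>W i\<close>, so avoiding it forces a partial sum of at least \<open>W i + b i\<close>.
    For other \<open>i\<close> only the size of \<open>M i\<close> matters.\<close>
  define M where "M i = (if i \<in> S then {int (W i)..<int (W i + b i)} else {0..<int (b i)})" for i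
  have "\<forall>i\<in>{1..k-1}. finite (M i) \<and> card (M i) = b i" by (auto simp: M_def)
  moreover have "inj_on int {1..k}" by simp
  ultimately obtain \<pi> where \<pi>: "\<pi> permutes {1..k}"
    and avoid: "\<And>i. i \<in> {1..k-1} \<Longrightarrow> (\<Sum>j = 1..i. int (\<pi> j)) \<notin> M i"
    using assms[unfolded admissible_def, rule_format, of int M] by blast
  define p where "p i = (\<Sum>j=1..i. \<pi> j)" for i
  have lower: "W i \<le> p i" if "i \<le> k" for i
    using that
  proof (induction i rule: less_induct)
    case (less i)
    show ?case
    proof (cases "i = 0")
      case True
      then show ?thesis by (simp add: W_def)
    next
      case False
      \<comment> \<open>The induction goes back from \<open>i\<close> to the preceding element of
        \<open>S\<close>: avoiding \<open>M q\<close> gives \<open>p q\<close> at least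
        \<open>W q + b q\<close>, and the block after \<open>q\<close> adds at least
        \<open>1 + ... + (i - q)\<close>. If \<open>q = 0\<close>, there is only the block.\<close>
      define q where "q = prev S i"
      have q: "q = 0 \<or> q \<in> S" "q < i" using prev_cases[of S i] False by (auto simp: q_def)
      have split: "(\<Sum>j=1..i. f j) = (\<Sum>j=1..q. f j) + (\<Sum>j\<in>{q<..i}. f j)" for f :: "nat \<Rightarrow> nat"
      proof -
        have "{1..i} = {1..q} \<union> {q<..i}" using q by auto
        moreover have "{1..q} \<inter> {q<..i} = {}" by auto
        ultimately show ?thesis
          using sum.union_disjoint[of "{1..q}" "{q<..i}" f] by simp
      qed
      have qmax: "s \<le> q" if "s \<in> S" "s < i" for s
        using le_prev[OF that] by (simp add: q_def)
      have block: "(\<Sum>j\<in>{q<..i}. j - prev S j) = (\<Sum>j\<in>{q<..i}. j - q)"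
      proof (rule sum.cong)
        fix j assume "j \<in> {q<..i}"
        then have "prev S j = q" using q(1) qmax by (intro prev_eqI[of q S i j]) auto
        then show "j - prev S j = j - q" by simp
      qed simp
      have ge: "(\<Sum>j\<in>{q<..i}. j - q) \<le> (\<Sum>j\<in>{q<..i}. \<pi> j)"
      proof (rule sum_inj_on_block_ge)
        show "inj_on \<pi> {q<..i}" using permutes_inj[OF \<pi>] by (rule inj_on_subset) simp
        show "0 < \<pi> j" if "j \<in> {q<..i}" for j
          using that less.prems permutes_in_image[OF \<pi>, of j] by auto
      qed
      show ?thesis
      proof (cases "q \<in> S")
        case True
        have "{s. s \<in> S \<and> s < i} = insert q {s. s \<in> S \<and> s < q}"
        proof (rule set_eqI)
          fix s
          show "s \<in> {s. s \<in> S \<and> s < i} \<longleftrightarrow> s \<in> insert q {s. s \<in> S \<and> s < q}"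
            using True q(2) qmax[of s] by auto
        qed
        then have W: "W i = W q + b q + (\<Sum>j\<in>{q<..i}. j - q)"
          using finS split[of "\<lambda>j. j - prev S j"] block by (simp add: W_def)
        have "W q \<le> p q" using less q by simp
        moreover have "int (p q) \<notin> M q"
          using avoid[of q] True S by (auto simp: p_def)
        ultimately have "W q + b q \<le> p q" using True by (auto simp: M_def)
        then show ?thesis using W ge split[of \<pi>] by (simp add: p_def)
      next
        case False
        then have q0: "q = 0" using q by simp
        then have "{s. s \<in> S \<and> s < i} = {}" using qmax S by fastforce
        then have "W i = (\<Sum>j=1..i. j - prev S j)" unfolding W_def by (simp only: sum.empty add_0)
        then show ?thesis
          using split[of "\<lambda>j. j - prev S j"] split[of \<pi>] block ge q0 by (simp add: p_def)
      qed
    qed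
  qed
  \<comment> \<open>The bound at \<open>i = k\<close> says that the sum of \<open>b\<close> over
    \<open>S\<close> is at most the sum of all \<open>prev S j\<close>, hence at most the number of
    intervals meeting \<open>S\<close>, against the choice of \<open>S\<close>.\<close>
  have "p k = \<Sum>{1..k}"
    unfolding p_def using sum.permute[OF \<pi>, of "\<lambda>x. x"] by (simp add: o_def)
  moreover have "{s. s \<in> S \<and> s < k} = S" using S by fastforce
  ultimately have "(\<Sum>s\<in>S. b s) + (\<Sum>j=1..k. j - prev S j) \<le> \<Sum>{1..k}"
    using lower[of k] by (simp add: W_def)
  moreover have "(\<Sum>j=1..k. j - prev S j) + (\<Sum>j=1..k. prev S j) = \<Sum>{1..k}"
  proof -
    have "prev S j \<le> j" for j using prev_cases[of S j] by auto
    then show ?thesis by (simp flip: sum.distrib)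
  qed
  ultimately show False
    using viol sum_prev_le_card_hit[of S k] by linarith
qed

subsection \<open>The Vandermonde product and permanents\<close>

text \<open>This is a determinant with two equal rows. Composing with the transposition of
  \<open>p\<close> and \<open>q\<close> flips each sign and keeps each product, so the sum equals
  its own negative.\<close>

lemma alternating_sum_eq_rows:
  fixes h :: "'a \<Rightarrow> 'a \<Rightarrow> int"
  assumes "finite S" "p \<in> S" "q \<in> S" "p \<noteq> q" "h p = h q"
  shows "(\<Sum>\<pi> | \<pi> permutes S. sign \<pi> * (\<Prod>j\<in>S. h j (\<pi> j))) = 0"
proof -
  let ?t = "transpose p q"
  have t: "?t permutes S" using assms by (intro permutes_swap_id)
  have "(\<Sum>\<pi> | \<pi> permutes S. sign \<pi> * (\<Prod>j\<in>S. h j (\<pi> j)))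
      = (\<Sum>\<pi> | \<pi> permutes S. sign (\<pi> \<circ> ?t) * (\<Prod>j\<in>S. h j ((\<pi> \<circ> ?t) j)))"
    by (rule sum_permutations_compose_right[OF t])
  also have "\<dots> = (\<Sum>\<pi> | \<pi> permutes S. - (sign \<pi> * (\<Prod>j\<in>S. h j (\<pi> j))))"
  proof (rule sum.cong)
    fix \<pi> assume "\<pi> \<in> {\<pi>. \<pi> permutes S}"
    then have "permutation \<pi>" using assms(1) by (auto intro: permutes_imp_permutation)
    then have s: "sign (\<pi> \<circ> ?t) = - sign \<pi>"
      using assms(4) by (simp add: sign_compose permutation_swap_id sign_swap_id)
    have "(\<Prod>j\<in>S. h j ((\<pi> \<circ> ?t) j)) = (\<Prod>j\<in>S. h (?t j) (\<pi> (?t j)))"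
      using assms(5) by (intro prod.cong) (auto simp: transpose_def)
    also have "\<dots> = (\<Prod>j\<in>S. h j (\<pi> j))"
      using prod.permute[OF t, of "\<lambda>j. h j (\<pi> j)"] by (simp add: o_def)
    finally show "sign (\<pi> \<circ> ?t) * (\<Prod>j\<in>S. h j ((\<pi> \<circ> ?t) j)) = - (sign \<pi> * (\<Prod>j\<in>S. h j (\<pi> j)))"
      using s by simp
  qed simp
  finally show ?thesis by (simp add: sum_negf)
qed

definition vandermonde_sum :: "nat \<Rightarrow> (nat \<Rightarrow> int) \<Rightarrow> int" where
  "vandermonde_sum k x = (\<Sum>\<sigma> | \<sigma> permutes {1..k}. sign \<sigma> * (\<Prod>j\<in>{1..k}. x j ^ (\<sigma> j - 1)))"

lemma vandermonde_sum_eq_0: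
  assumes "\<not> inj_on x {1..k}"
  shows "vandermonde_sum k x = 0"
proof -
  obtain p q where pq: "p \<in> {1..k}" "q \<in> {1..k}" "p \<noteq> q" "x p = x q"
    using assms by (auto simp: inj_on_def)
  show ?thesis
    unfolding vandermonde_sum_def
    by (rule alternating_sum_eq_rows[where h = "\<lambda>j i. x j ^ (i - 1)" and p = p and q = q])
      (use pq in auto)
qed

text \<open>Both sides are compared as polynomials in the last variable. If \<open>x\<close> is not
  injective on \<open>{1..k}\<close>, both vanish; otherwise they have the same coefficient at
  \<open>k\<close>, degree at most \<open>k\<close>, and the \<open>k\<close> common roots
  \<open>x 1, ..., x k\<close>.\<close>

lemma vandermonde_sum_Suc:
  "vandermonde_sum (Suc k) x = vandermonde_sum k x * (\<Prod>p\<in>{1..k}. x (Suc k) - x p)"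
proof (cases "inj_on x {1..k}")
  case False
  then have "\<not> inj_on x {1..Suc k}" by (meson atLeastatMost_subset_iff inj_on_subset le_SucI order_refl)
  then show ?thesis using False by (simp add: vandermonde_sum_eq_0)
next
  case True
  let ?P = "{\<sigma>. \<sigma> permutes {1..Suc k}}"
  define c where "c \<sigma> = sign \<sigma> * (\<Prod>j\<in>{1..k}. x j ^ (\<sigma> j - 1))" for \<sigma> :: "nat \<Rightarrow> nat"
  define F where "F = (\<Sum>\<sigma>\<in>?P. monom (c \<sigma>) (\<sigma> (Suc k) - 1))"
  define G where "G = smult (vandermonde_sum k x) (\<Prod>p\<in>{1..k}. [:- x p, 1:])"
  have fin: "finite ?P" by (intro finite_permutations) simp
  have F: "poly F y = vandermonde_sum (Suc k) (x(Suc k := y))" for y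
  proof -
    have "(\<Prod>j\<in>{1..Suc k}. (x(Suc k := y)) j ^ (\<sigma> j - 1))
        = y ^ (\<sigma> (Suc k) - 1) * (\<Prod>j\<in>{1..k}. x j ^ (\<sigma> j - 1))" for \<sigma> :: "nat \<Rightarrow> nat"
    proof -
      have "(\<Prod>j\<in>{1..k}. (x(Suc k := y)) j ^ (\<sigma> j - 1)) = (\<Prod>j\<in>{1..k}. x j ^ (\<sigma> j - 1))"
        by (rule prod.cong) auto
      then show ?thesis by (simp add: atLeastAtMostSuc_conv mult.commute)
    qed
    then show ?thesis
      unfolding F_def vandermonde_sum_def c_def
      by (simp add: poly_sum poly_monom mult_ac)
  qed
  have coeffF: "coeff F k = vandermonde_sum k x"
  proof -
    \<comment> \<open>Degree \<open>k\<close> is reached exactly when \<open>\<sigma>\<close> fixes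
      \<open>Suc k\<close>, that is, when \<open>\<sigma>\<close> is a permutation of
      \<open>{1..k}\<close>.\<close>
    have "coeff F k = (\<Sum>\<sigma>\<in>?P. if \<sigma> (Suc k) = Suc k then c \<sigma> else 0)"
      unfolding F_def coeff_sum
    proof (rule sum.cong)
      fix \<sigma> assume "\<sigma> \<in> ?P"
      then have "\<sigma> (Suc k) \<in> {1..Suc k}" using permutes_in_image[of \<sigma> "{1..Suc k}" "Suc k"] by auto
      then show "coeff (monom (c \<sigma>) (\<sigma> (Suc k) - 1)) k = (if \<sigma> (Suc k) = Suc k then c \<sigma> else 0)"
        by auto
    qed simp
    also have "\<dots> = (\<Sum>\<sigma> | \<sigma> permutes {1..k}. c \<sigma>)"
    proof -
      have "{\<sigma> \<in> ?P. \<sigma> (Suc k) = Suc k} = {\<sigma>. \<sigma> permutes {1..k}}"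
      proof (intro set_eqI iffI)
        fix \<sigma> assume "\<sigma> \<in> {\<sigma> \<in> ?P. \<sigma> (Suc k) = Suc k}"
        then have "\<sigma> permutes {1..Suc k}" "\<sigma> (Suc k) = Suc k" by auto
        then show "\<sigma> \<in> {\<sigma>. \<sigma> permutes {1..k}}"
          using permutes_superset[of \<sigma> "{1..Suc k}" "{1..k}"] by (auto simp: le_Suc_eq)
      next
        fix \<sigma> assume "\<sigma> \<in> {\<sigma>. \<sigma> permutes {1..k}}"
        then have s: "\<sigma> permutes {1..k}" by simp
        then have "\<sigma> permutes {1..Suc k}" by (rule permutes_subset) auto
        moreover have "\<sigma> (Suc k) = Suc k" using s by (rule permutes_not_in) auto
        ultimately show "\<sigma> \<in> {\<sigma> \<in> ?P. \<sigma> (Suc k) = Suc k}" by simp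
      qed
      then show ?thesis using fin by (simp add: sum.If_cases Int_def)
    qed
    finally show ?thesis by (simp add: vandermonde_sum_def c_def)
  qed
  have degF: "degree F \<le> k"
    unfolding F_def
  proof (rule degree_sum_le[OF fin])
    fix \<sigma> assume "\<sigma> \<in> ?P"
    then have "\<sigma> (Suc k) \<le> Suc k" using permutes_in_image[of \<sigma> "{1..Suc k}" "Suc k"] by auto
    then show "degree (monom (c \<sigma>) (\<sigma> (Suc k) - 1)) \<le> k"
      using degree_monom_le[of "c \<sigma>" "\<sigma> (Suc k) - 1"] by linarith
  qed
  have degP: "degree (\<Prod>p\<in>{1..k}. [:- x p, 1:]) = k"
    by (subst degree_prod_eq_sum_degree) auto
  have lcP: "lead_coeff (\<Prod>p\<in>{1..k}. [:- x p, 1:]) = 1"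
    unfolding lead_coeff_prod by simp
  have "F = G"
  proof (rule poly_eqI_degree_lead_coeff[of F k G "x ` {1..k}"])
    show "coeff F k = coeff G k"
      unfolding coeffF G_def using degP lcP by simp
    show "k \<le> card (x ` {1..k})" using True by (simp add: card_image)
    show "degree F \<le> k" by (rule degF)
    show "degree G \<le> k" unfolding G_def using degree_smult_le degP by metis
    fix z assume "z \<in> x ` {1..k}"
    then obtain p where p: "p \<in> {1..k}" "z = x p" by blast
    have "\<not> inj_on (x(Suc k := z)) {1..Suc k}"
    proof
      assume "inj_on (x(Suc k := z)) {1..Suc k}"
      from inj_onD[OF this, of "Suc k" p] show False using p by auto
    qed
    then have "poly F z = 0" by (simp add: F vandermonde_sum_eq_0)
    moreover have "poly G z = 0"
      using p by (auto simp: G_def poly_prod)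
    ultimately show "poly F z = poly G z" by simp
  qed
  then have "vandermonde_sum (Suc k) (x(Suc k := x (Suc k))) = poly G (x (Suc k))"
    using F[of "x (Suc k)"] by simp
  then show ?thesis by (simp add: G_def poly_prod)
qed

lemma upper_class_Suc:
  "upper_class (Suc k) = upper_class k \<union> (\<lambda>j. (j, k)) ` {1..k}"
  by (auto simp: upper_class_def)

text \<open>The interval \<open>(j, l)\<close> labels the pair of indices \<open>j < l + 1\<close>.
  The intervals that are new for \<open>Suc k\<close> end in \<open>k\<close> and carry the factors
  containing \<open>x (Suc k)\<close>.\<close>

lemma vandermonde_sum_eq_prod:
  "vandermonde_sum k x = (\<Prod>s\<in>upper_class k. x (snd s + 1) - x (fst s))"
proof (induction k)
  case 0
  have "upper_class 0 = {}" by (auto simp: upper_class_def)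
  then show ?case by (simp add: vandermonde_sum_def)
next
  case (Suc k)
  have disj: "upper_class k \<inter> (\<lambda>j. (j, k)) ` {1..k} = {}" by (auto simp: upper_class_def)
  have "(\<Prod>s\<in>(\<lambda>j. (j, k)) ` {1..k}. x (snd s + 1) - x (fst s)) = (\<Prod>p\<in>{1..k}. x (Suc k) - x p)"
    by (subst prod.reindex) (auto simp: inj_on_def)
  then show ?case
    unfolding vandermonde_sum_Suc upper_class_Suc Suc.IH
    by (subst prod.union_disjoint[OF _ _ disj]) auto
qed

section \<open>Ryser's formula and counting permutations\<close>

lemma sum_Pow_alternating:
  assumes "finite B"
  shows "(\<Sum>X\<in>Pow B. (-1) ^ card X) = (if B = {} then 1 else (0::int))"
proof -
  have "(\<Sum>X\<in>Pow B. (-1) ^ card X) = (\<Prod>x\<in>B. (1::int) - 1)"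
    using assms by (subst prod_diff_conv_sum) auto
  then show ?thesis using assms by (auto simp: card_gt_0_iff power_0_left)
qed

text \<open>Each product expands over maps \<open>f\<close> from \<open>U\<close> to
  \<open>U\<close>, where \<open>f s\<close> is the column chosen in row \<open>s\<close>. The map
  \<open>f\<close> occurs for every \<open>R\<close> containing its image, and the signs cancel
  unless \<open>f\<close> is onto, hence a permutation.\<close>

lemma ryser_permanent:
  fixes A :: "'a \<Rightarrow> 'a \<Rightarrow> int"
  assumes fin: "finite U"
  shows "(\<Sum>R\<in>Pow U. (-1) ^ card (U - R) * (\<Prod>s\<in>U. \<Sum>d\<in>R. A s d))
       = (\<Sum>\<rho> | \<rho> permutes U. \<Prod>d\<in>U. A (\<rho> d) d)"
proof -
  let ?E = "PiE U (\<lambda>_. U)"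
  have finE: "finite ?E" using fin by (intro finite_PiE) auto
  have "(\<Sum>R\<in>Pow U. (-1) ^ card (U - R) * (\<Prod>s\<in>U. \<Sum>d\<in>R. A s d))
      = (\<Sum>R\<in>Pow U. \<Sum>f\<in>?E. if f ` U \<subseteq> R then (-1) ^ card (U - R) * (\<Prod>s\<in>U. A s (f s)) else 0)"
  proof (rule sum.cong)
    fix R assume R: "R \<in> Pow U"
    then have finR: "finite R" using fin by (auto intro: finite_subset)
    have "{f \<in> ?E. f ` U \<subseteq> R} = PiE U (\<lambda>_. R)"
      using R by (auto simp: PiE_def Pi_def extensional_def)
    then show "(-1) ^ card (U - R) * (\<Prod>s\<in>U. \<Sum>d\<in>R. A s d)
      = (\<Sum>f\<in>?E. if f ` U \<subseteq> R then (-1) ^ card (U - R) * (\<Prod>s\<in>U. A s (f s)) else 0)"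
      using fin finR finE
      by (simp add: prod_sum_PiE sum_distrib_left sum.inter_filter[symmetric])
  qed simp
  also have "\<dots> = (\<Sum>f\<in>?E. \<Sum>R\<in>Pow U. if f ` U \<subseteq> R then (-1) ^ card (U - R) * (\<Prod>s\<in>U. A s (f s)) else 0)"
    by (rule sum.swap)
  also have "\<dots> = (\<Sum>f\<in>?E. if f ` U = U then \<Prod>s\<in>U. A s (f s) else 0)"
  proof (rule sum.cong)
    fix f assume f: "f \<in> ?E"
    have sub: "f ` U \<subseteq> U" using f by auto
    have "(\<Sum>R\<in>Pow U. if f ` U \<subseteq> R then (-1) ^ card (U - R) * (\<Prod>s\<in>U. A s (f s)) else 0)
        = (\<Sum>R | R \<in> Pow U \<and> f ` U \<subseteq> R. (-1) ^ card (U - R)) * (\<Prod>s\<in>U. A s (f s))"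
      using fin by (simp add: sum.inter_filter[symmetric] sum_distrib_right)
    also have "(\<Sum>R | R \<in> Pow U \<and> f ` U \<subseteq> R. (-1) ^ card (U - R)) = (\<Sum>X\<in>Pow (U - f ` U). (-1) ^ card X :: int)"
      using sub
      by (intro sum.reindex_bij_witness[of _ "\<lambda>X. U - X" "\<lambda>R. U - R"]) (auto simp: double_diff)
    also have "\<dots> = (if f ` U = U then 1 else 0)"
      using fin sub by (subst sum_Pow_alternating) auto
    finally show "(\<Sum>R\<in>Pow U. if f ` U \<subseteq> R then (-1) ^ card (U - R) * (\<Prod>s\<in>U. A s (f s)) else 0)
        = (if f ` U = U then \<Prod>s\<in>U. A s (f s) else 0)" by simp
  qed simp
  also have "\<dots> = (\<Sum>f\<in>{f \<in> ?E. f ` U = U}. \<Prod>s\<in>U. A s (f s))"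
    using finE by (simp add: sum.inter_filter[symmetric])
  also have "\<dots> = (\<Sum>\<rho> | \<rho> permutes U. \<Prod>s\<in>U. A s (\<rho> s))"
  proof (rule sum.reindex_bij_witness[of _ "\<lambda>\<rho>. restrict \<rho> U" "\<lambda>f s. if s \<in> U then f s else s"])
    fix f assume f: "f \<in> {f \<in> ?E. f ` U = U}"
    then have "bij_betw f U U" using fin by (auto simp: bij_betw_def intro: finite_surj_inj)
    then have "bij_betw (\<lambda>s. if s \<in> U then f s else s) U U"
      by (subst bij_betw_cong[of U _ f]) auto
    then show "(\<lambda>s. if s \<in> U then f s else s) \<in> {\<rho>. \<rho> permutes U}"
      using bij_imp_permutes by fastforce
  next
    fix \<rho> assume "\<rho> \<in> {\<rho>. \<rho> permutes U}"
    then have r: "\<rho> permutes U" by simp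
    show "restrict \<rho> U \<in> {f \<in> ?E. f ` U = U}"
      using permutes_image[OF r] permutes_in_image[OF r] by auto
    show "(\<lambda>s. if s \<in> U then restrict \<rho> U s else s) = \<rho>"
      using permutes_not_in[OF r] by auto
  qed (auto simp: fun_eq_iff PiE_def extensional_def)
  \<comment> \<open>Inverting turns the choice of a column for each row into the choice of a row for
    each column.\<close>
  also have "\<dots> = (\<Sum>\<rho> | \<rho> permutes U. \<Prod>s\<in>U. A s (inv \<rho> s))"
    by (rule sum_permutations_inverse)
  also have "\<dots> = (\<Sum>\<rho> | \<rho> permutes U. \<Prod>d\<in>U. A (\<rho> d) d)"
  proof (rule sum.cong)
    fix \<rho> assume "\<rho> \<in> {\<rho>. \<rho> permutes U}"
    then have r: "\<rho> permutes U" by simp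
    show "(\<Prod>s\<in>U. A s (inv \<rho> s)) = (\<Prod>d\<in>U. A (\<rho> d) d)"
      using prod.permute[OF r, of "\<lambda>s. A s (inv \<rho> s)"] permutes_inverses[OF r] by (simp add: o_def)
  qed simp
  finally show ?thesis .
qed

text \<open>Composition with one solution \<open>\<rho>\<^sub>0\<close> carries the permutations
  preserving \<open>r\<close> bijectively to the solutions, so the count does not depend on
  \<open>\<psi>\<close>.\<close>

lemma card_permutations_prescribed:
  assumes "\<rho>\<^sub>0 permutes U" and "\<forall>d\<in>U. r (\<rho>\<^sub>0 d) = \<psi> d"
  shows "card {\<rho>. \<rho> permutes U \<and> (\<forall>d\<in>U. r (\<rho> d) = \<psi> d)}
       = card {\<tau>. \<tau> permutes U \<and> (\<forall>d\<in>U. r (\<tau> d) = r d)}"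
proof (rule bij_betw_same_card[symmetric])
  have inv: "inv \<rho>\<^sub>0 permutes U" using assms(1) by (rule permutes_inv)
  show "bij_betw (\<lambda>\<tau>. \<tau> \<circ> \<rho>\<^sub>0) {\<tau>. \<tau> permutes U \<and> (\<forall>d\<in>U. r (\<tau> d) = r d)}
     {\<rho>. \<rho> permutes U \<and> (\<forall>d\<in>U. r (\<rho> d) = \<psi> d)}"
  proof (rule bij_betw_byWitness[where f' = "\<lambda>\<rho>. \<rho> \<circ> inv \<rho>\<^sub>0"])
    show "(\<lambda>\<tau>. \<tau> \<circ> \<rho>\<^sub>0) ` {\<tau>. \<tau> permutes U \<and> (\<forall>d\<in>U. r (\<tau> d) = r d)}
        \<subseteq> {\<rho>. \<rho> permutes U \<and> (\<forall>d\<in>U. r (\<rho> d) = \<psi> d)}"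
      using assms permutes_in_image[OF assms(1)] by (auto intro: permutes_compose)
    show "(\<lambda>\<rho>. \<rho> \<circ> inv \<rho>\<^sub>0) ` {\<rho>. \<rho> permutes U \<and> (\<forall>d\<in>U. r (\<rho> d) = \<psi> d)}
        \<subseteq> {\<tau>. \<tau> permutes U \<and> (\<forall>d\<in>U. r (\<tau> d) = r d)}"
    proof
      fix \<tau> assume "\<tau> \<in> (\<lambda>\<rho>. \<rho> \<circ> inv \<rho>\<^sub>0) ` {\<rho>. \<rho> permutes U \<and> (\<forall>d\<in>U. r (\<rho> d) = \<psi> d)}"
      then obtain \<rho> where \<rho>: "\<rho> permutes U" "\<forall>d\<in>U. r (\<rho> d) = \<psi> d" "\<tau> = \<rho> \<circ> inv \<rho>\<^sub>0" by blast
      have "r (\<tau> d) = r d" if "d \<in> U" for d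
      proof -
        have "inv \<rho>\<^sub>0 d \<in> U" using that permutes_in_image[OF inv] by simp
        then have "r (\<tau> d) = r (\<rho>\<^sub>0 (inv \<rho>\<^sub>0 d))" using \<rho> assms(2) by simp
        then show ?thesis using permutes_inverses(1)[OF assms(1)] by simp
      qed
      then show "\<tau> \<in> {\<tau>. \<tau> permutes U \<and> (\<forall>d\<in>U. r (\<tau> d) = r d)}"
        using \<rho> inv permutes_compose by blast
    qed
  qed (use permutes_inv_o[OF assms(1)] in \<open>auto simp: comp_assoc\<close>)
qed

subsection \<open>Matching sequences are admissible\<close>

lemma card_upper_class_row:
  assumes "m \<in> {1..k}"
  shows "card {s \<in> upper_class k. Suc (snd s) = m} = m - 1"
proof -
  have "{s \<in> upper_class k. Suc (snd s) = m} = (\<lambda>j. (j, m - 1)) ` {1..m - 1}"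
    using assms by (auto simp: upper_class_def)
  then show ?thesis by (simp add: card_image inj_on_def)
qed

lemma Suc_snd_upper_class: "s \<in> upper_class k \<Longrightarrow> Suc (snd s) \<in> {1..k}"
  by (auto simp: upper_class_def)

lemma card_upper_class: "card (upper_class k) = \<Sum>{..<k}"
proof -
  have "card (upper_class k) = (\<Sum>m\<in>{1..k}. \<Sum>s | s \<in> upper_class k \<and> Suc (snd s) = m. 1)"
    using sum.group[of "upper_class k" "{1..k}" "\<lambda>s. Suc (snd s)" "\<lambda>_. 1::nat"] Suc_snd_upper_class
    by (simp add: image_subset_iff)
  also have "\<dots> = (\<Sum>m\<in>{1..k}. m - 1)"
    using card_upper_class_row by (intro sum.cong) auto
  also have "\<dots> = \<Sum>{..<k}"
    by (rule sum.reindex_bij_witness[of _ Suc "\<lambda>m. m - 1"]) auto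
  finally show ?thesis .
qed

text \<open>Spreads a monomial with the Vandermonde exponents \<open>m - 1\<close> over the
  intervals, one factor for each, which is the shape Ryser's formula works with.\<close>

lemma prod_upper_class_row:
  fixes f :: "nat \<Rightarrow> int"
  shows "(\<Prod>s\<in>upper_class k. f (Suc (snd s))) = (\<Prod>m\<in>{1..k}. f m ^ (m - 1))"
proof -
  have "(\<Prod>s\<in>upper_class k. f (Suc (snd s)))
      = (\<Prod>m\<in>{1..k}. \<Prod>s | s \<in> upper_class k \<and> Suc (snd s) = m. f (Suc (snd s)))"
    using Suc_snd_upper_class by (intro prod.group[symmetric]) auto
  also have "\<dots> = (\<Prod>m\<in>{1..k}. f m ^ (m - 1))"
  proof (rule prod.cong)
    fix m assume m: "m \<in> {1..k}"
    have "(\<Prod>s | s \<in> upper_class k \<and> Suc (snd s) = m. f (Suc (snd s)))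
        = (\<Prod>s | s \<in> upper_class k \<and> Suc (snd s) = m. f m)"
      by (rule prod.cong) auto
    then show "(\<Prod>s | s \<in> upper_class k \<and> Suc (snd s) = m. f (Suc (snd s))) = f m ^ (m - 1)"
      using card_upper_class_row[OF m] by simp
  qed simp
  finally show ?thesis .
qed

section \<open>Alternating sums of monomials\<close>

text \<open>After inverting \<open>\<pi>\<close> and reordering the factors, the exponents are those
  of \<open>\<sigma> \<circ> \<pi>\<close>; summing over this composition instead of
  \<open>\<pi>\<close> costs only \<open>sign \<sigma>\<close>.\<close>

lemma alternating_sum_permuted_exponents:
  assumes \<sigma>: "\<sigma> permutes {1..k}"
  shows "(\<Sum>\<pi> | \<pi> permutes {1..k}. sign \<pi> * (\<Prod>j\<in>{1..k}. a (\<pi> j) ^ (\<sigma> j - 1)))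
       = sign \<sigma> * vandermonde_sum k a"
proof -
  let ?P = "{\<pi>. \<pi> permutes {1..k}}"
  define F where "F \<tau> = (\<Prod>j\<in>{1..k}. a j ^ (\<tau> j - 1))" for \<tau> :: "nat \<Rightarrow> nat"
  have "(\<Sum>\<pi>\<in>?P. sign \<pi> * (\<Prod>j\<in>{1..k}. a (\<pi> j) ^ (\<sigma> j - 1)))
      = (\<Sum>\<pi>\<in>?P. sign (inv \<pi>) * (\<Prod>j\<in>{1..k}. a (inv \<pi> j) ^ (\<sigma> j - 1)))"
    by (rule sum_permutations_inverse)
  also have "\<dots> = (\<Sum>\<pi>\<in>?P. sign \<sigma> * (sign (\<sigma> \<circ> \<pi>) * F (\<sigma> \<circ> \<pi>)))"
  proof (rule sum.cong)
    fix \<pi> assume "\<pi> \<in> ?P"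
    then have \<pi>: "\<pi> permutes {1..k}" by simp
    have perm: "permutation \<pi>" "permutation \<sigma>"
      using \<pi> \<sigma> by (auto intro: permutes_imp_permutation[rotated])
    have "(\<Prod>j\<in>{1..k}. a (inv \<pi> j) ^ (\<sigma> j - 1)) = F (\<sigma> \<circ> \<pi>)"
      using prod.permute[OF \<pi>, of "\<lambda>j. a (inv \<pi> j) ^ (\<sigma> j - 1)"] permutes_inverses[OF \<pi>]
      by (simp add: F_def o_def)
    moreover have "sign \<sigma> * sign (\<sigma> \<circ> \<pi>) = sign (inv \<pi>)"
      using perm by (simp add: sign_compose sign_inverse flip: mult.assoc)
    ultimately show "sign (inv \<pi>) * (\<Prod>j\<in>{1..k}. a (inv \<pi> j) ^ (\<sigma> j - 1))
        = sign \<sigma> * (sign (\<sigma> \<circ> \<pi>) * F (\<sigma> \<circ> \<pi>))"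
      by (simp flip: mult.assoc)
  qed simp
  also have "\<dots> = sign \<sigma> * (\<Sum>\<pi>\<in>?P. sign \<pi> * F \<pi>)"
    using setum_permutations_compose_left[OF \<sigma>, of "\<lambda>\<pi>. sign \<pi> * F \<pi>"]
    by (simp add: sum_distrib_left)
  finally show ?thesis by (simp add: vandermonde_sum_def F_def)
qed

lemma prod_fibres:
  fixes a :: "nat \<Rightarrow> int"
  assumes "finite U" and "\<phi> \<in> U \<rightarrow> {0..k}"
  shows "(\<Prod>d\<in>U. if \<phi> d = 0 then c d else a (\<phi> d))
       = (\<Prod>d | d \<in> U \<and> \<phi> d = 0. c d) * (\<Prod>j\<in>{1..k}. a j ^ card {d \<in> U. \<phi> d = j})"
proof -
  let ?f = "\<lambda>d. if \<phi> d = 0 then c d else a (\<phi> d)"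
  have "prod ?f U = (\<Prod>j\<in>{0..k}. \<Prod>d | d \<in> U \<and> \<phi> d = j. ?f d)"
    using assms by (intro prod.group[symmetric]) auto
  also have "\<dots> = (\<Prod>d | d \<in> U \<and> \<phi> d = 0. ?f d) * (\<Prod>j\<in>{1..k}. \<Prod>d | d \<in> U \<and> \<phi> d = j. ?f d)"
    by (subst atLeast0AtMost, subst prod.atMost_shift) (simp add: prod.atLeast1_atMost_eq)
  also have "(\<Prod>d | d \<in> U \<and> \<phi> d = 0. ?f d) = (\<Prod>d | d \<in> U \<and> \<phi> d = 0. c d)"
    by (rule prod.cong) auto
  also have "(\<Prod>j\<in>{1..k}. \<Prod>d | d \<in> U \<and> \<phi> d = j. ?f d) = (\<Prod>j\<in>{1..k}. a j ^ card {d \<in> U. \<phi> d = j})"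
  proof (rule prod.cong)
    fix j assume "j \<in> {1..k}"
    then have "(\<Prod>d | d \<in> U \<and> \<phi> d = j. ?f d) = (\<Prod>d | d \<in> U \<and> \<phi> d = j. a j)"
      by (intro prod.cong) auto
    then show "(\<Prod>d | d \<in> U \<and> \<phi> d = j. ?f d) = a j ^ card {d \<in> U. \<phi> d = j}" by simp
  qed simp
  finally show ?thesis .
qed

text \<open>The degree bound: the fibre sizes over \<open>0..k\<close> sum to
  \<open>card U = 0 + ... + (k - 1)\<close>, the least sum of \<open>k\<close> distinct naturals. So
  the sizes over \<open>1..k\<close> are \<open>0, ..., k - 1\<close> in some order, and no factor
  is left to contribute its constant.\<close>

lemma distinct_fibre_cards:
  assumes \<phi>: "\<phi> \<in> upper_class k \<rightarrow> {0..k}"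
    and inj: "inj_on (\<lambda>j. card {d \<in> upper_class k. \<phi> d = j}) {1..k}"
  obtains \<sigma> where "\<sigma> permutes {1..k}"
    and "\<And>j. j \<in> {1..k} \<Longrightarrow> card {d \<in> upper_class k. \<phi> d = j} = \<sigma> j - 1"
    and "\<And>d. d \<in> upper_class k \<Longrightarrow> \<phi> d \<noteq> 0"
proof -
  let ?U = "upper_class k"
  define e where "e j = card {d \<in> ?U. \<phi> d = j}" for j
  have inj: "inj_on e {1..k}" using inj unfolding e_def .
  have "card ?U = (\<Sum>j\<in>{0..k}. e j)"
    using sum.group[of ?U "{0..k}" \<phi> "\<lambda>_. 1::nat"] \<phi> by (simp add: e_def image_subset_iff Pi_iff)
  also have "\<dots> = e 0 + (\<Sum>j\<in>{1..k}. e j)"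
    by (simp add: sum.atLeast_Suc_atMost)
  finally have total: "\<Sum>{..<k} = e 0 + \<Sum>(e ` {1..k})"
    using inj by (simp add: card_upper_class sum.reindex)
  have card_e: "card (e ` {1..k}) = k" using inj by (simp add: card_image)
  have img: "e ` {1..k} = {..<k}"
    using eq_lessThan_card_if_sum_le[of "e ` {1..k}"] total unfolding card_e by simp
  have e0: "e 0 = 0" using total img by simp
  define \<sigma> where "\<sigma> j = (if j \<in> {1..k} then Suc (e j) else j)" for j
  have "bij_betw (\<lambda>j. Suc (e j)) {1..k} {1..k}"
  proof (rule bij_betw_imageI)
    show "inj_on (\<lambda>j. Suc (e j)) {1..k}" by (rule inj_onI) (use inj_onD[OF inj] in blast)
    have "(\<lambda>j. Suc (e j)) ` {1..k} = Suc ` e ` {1..k}" by (simp add: image_image)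
    then show "(\<lambda>j. Suc (e j)) ` {1..k} = {1..k}"
      unfolding img by (simp add: image_Suc_lessThan)
  qed
  then have "bij_betw \<sigma> {1..k} {1..k}"
    by (subst bij_betw_cong[of _ _ "\<lambda>j. Suc (e j)"]) (auto simp: \<sigma>_def)
  then have "\<sigma> permutes {1..k}" by (rule bij_imp_permutes) (auto simp: \<sigma>_def)
  moreover have "\<phi> d \<noteq> 0" if "d \<in> ?U" for d
    using e0 that by (cases d) (auto simp: e_def)
  ultimately show thesis by (intro that) (auto simp: \<sigma>_def e_def)
qed

text \<open>\<open>\<rho>\<close> maps the fibre of \<open>\<phi>\<close> over \<open>j\<close>
  bijectively onto row \<open>\<sigma> j\<close>.\<close>

lemma card_fibre_if_rows_match:
  assumes \<sigma>: "\<sigma> permutes {1..k}" and \<rho>: "\<rho> permutes upper_class k"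
    and match: "\<forall>d\<in>upper_class k. Suc (snd (\<rho> d)) = \<sigma> (\<phi> d)" and j: "j \<in> {1..k}"
  shows "card {d \<in> upper_class k. \<phi> d = j} = \<sigma> j - 1"
proof -
  have inj\<sigma>: "\<sigma> x = \<sigma> y \<longleftrightarrow> x = y" for x y using permutes_inj[OF \<sigma>] by (simp add: inj_eq)
  have "{d \<in> upper_class k. Suc (snd d) = \<sigma> j} = \<rho> ` {d \<in> upper_class k. \<phi> d = j}"
  proof (intro set_eqI iffI)
    fix s assume s: "s \<in> {d \<in> upper_class k. Suc (snd d) = \<sigma> j}"
    have "inv \<rho> s \<in> upper_class k"
      using s permutes_in_image[OF permutes_inv[OF \<rho>]] by simp
    moreover have "\<rho> (inv \<rho> s) = s" using permutes_inverses[OF \<rho>] by simp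
    ultimately show "s \<in> \<rho> ` {d \<in> upper_class k. \<phi> d = j}"
      using s match inj\<sigma> by (intro image_eqI[of _ _ "inv \<rho> s"]) (auto dest!: bspec[of _ _ "inv \<rho> s"])
  next
    fix s assume "s \<in> \<rho> ` {d \<in> upper_class k. \<phi> d = j}"
    then show "s \<in> {d \<in> upper_class k. Suc (snd d) = \<sigma> j}"
      using match permutes_in_image[OF \<rho>] by auto
  qed
  moreover have "inj_on \<rho> {d \<in> upper_class k. \<phi> d = j}"
    using permutes_inj[OF \<rho>] by (rule inj_on_subset) simp
  ultimately have "card {d \<in> upper_class k. \<phi> d = j} = card {d \<in> upper_class k. Suc (snd d) = \<sigma> j}"
    by (simp add: card_image)
  also have "\<dots> = \<sigma> j - 1"
    using j permutes_in_image[OF \<sigma>] by (intro card_upper_class_row) auto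
  finally show ?thesis .
qed

text \<open>By the fibre sizes, the labels \<open>\<sigma> (\<phi> d)\<close> and the row numbers
  \<open>Suc (snd d)\<close> form the same multiset, so a permutation rearranges one family into the
  other.\<close>

lemma ex_rows_match:
  assumes \<sigma>: "\<sigma> permutes {1..k}" and \<phi>: "\<phi> \<in> upper_class k \<rightarrow> {1..k}"
    and fib: "\<And>j. j \<in> {1..k} \<Longrightarrow> card {d \<in> upper_class k. \<phi> d = j} = \<sigma> j - 1"
  obtains \<rho> where "\<rho> permutes upper_class k" "\<forall>d\<in>upper_class k. Suc (snd (\<rho> d)) = \<sigma> (\<phi> d)"
proof -
  let ?U = "upper_class k"
  have "image_mset (\<lambda>d. \<sigma> (\<phi> d)) (mset_set ?U) = image_mset (\<lambda>d. Suc (snd d)) (mset_set ?U)"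
  proof (rule multiset_eqI)
    fix m
    have cnt: "count (image_mset f (mset_set ?U)) m = card {d \<in> ?U. f d = m}" for f :: "nat \<times> nat \<Rightarrow> nat"
    proof -
      have "count (image_mset f (mset_set ?U)) m = (\<Sum>x\<in>f -` {m} \<inter> ?U. 1)"
        by (simp add: count_image_mset)
      also have "f -` {m} \<inter> ?U = {d \<in> ?U. f d = m}" by auto
      finally show ?thesis by simp
    qed
    have "card {d \<in> ?U. \<sigma> (\<phi> d) = m} = card {d \<in> ?U. Suc (snd d) = m}"
    proof (cases "m \<in> {1..k}")
      case True
      define j where "j = inv \<sigma> m"
      have j: "j \<in> {1..k}" "\<sigma> j = m"
        using True permutes_in_image[OF permutes_inv[OF \<sigma>]] permutes_inverses[OF \<sigma>] by (auto simp: j_def)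
      have "\<sigma> x = m \<longleftrightarrow> x = j" for x using j permutes_inj[OF \<sigma>] by (auto simp: inj_def)
      then have "card {d \<in> ?U. \<sigma> (\<phi> d) = m} = \<sigma> j - 1" using fib j by simp
      then show ?thesis using card_upper_class_row[OF True] j by simp
    next
      case False
      then have "{d \<in> ?U. \<sigma> (\<phi> d) = m} = {}" "{d \<in> ?U. Suc (snd d) = m} = {}"
        using \<phi> permutes_in_image[OF \<sigma>] Suc_snd_upper_class by blast+
      then show ?thesis by (simp only:)
    qed
    then show "count (image_mset (\<lambda>d. \<sigma> (\<phi> d)) (mset_set ?U)) m
        = count (image_mset (\<lambda>d. Suc (snd d)) (mset_set ?U)) m"
      by (simp add: cnt)
  qed
  from image_mset_eq_implies_permutes[OF finite_upper_class this] that show thesis by metis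
qed

lemma vandermonde_sum_conv_upper_class:
  "vandermonde_sum k x
   = (\<Sum>\<sigma> | \<sigma> permutes {1..k}. sign \<sigma> * (\<Prod>s\<in>upper_class k. x (inv \<sigma> (Suc (snd s)))))"
  unfolding vandermonde_sum_def
proof (rule sum.cong)
  fix \<sigma> assume "\<sigma> \<in> {\<sigma>. \<sigma> permutes {1..k}}"
  then have \<sigma>: "\<sigma> permutes {1..k}" by simp
  have "(\<Prod>j\<in>{1..k}. x j ^ (\<sigma> j - 1)) = (\<Prod>m\<in>{1..k}. x (inv \<sigma> m) ^ (m - 1))"
    using prod.permute[OF permutes_inv[OF \<sigma>], of "\<lambda>j. x j ^ (\<sigma> j - 1)"] permutes_inverses[OF \<sigma>]
    by (simp add: o_def)
  also have "\<dots> = (\<Prod>s\<in>upper_class k. x (inv \<sigma> (Suc (snd s))))"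
    by (rule prod_upper_class_row[symmetric])
  finally show "sign \<sigma> * (\<Prod>j\<in>{1..k}. x j ^ (\<sigma> j - 1))
      = sign \<sigma> * (\<Prod>s\<in>upper_class k. x (inv \<sigma> (Suc (snd s))))" by simp
qed simp

text \<open>
  Here \<open>\<phi>\<close> describes one term in the expansion of the product: \<open>\<phi> d\<close> is the index of the summand
  chosen from factor \<open>d\<close>, and \<open>0\<close> stands for the constant. The row \<open>Suc (snd s) = m\<close> of the upper
  class has \<open>m - 1\<close> elements, so it plays the role of the exponent \<open>m - 1\<close>.
\<close>

lemma alternating_sum_monomial:
  fixes k :: nat and a :: "nat \<Rightarrow> int"
  defines "U \<equiv> upper_class k"
  assumes \<phi>: "\<phi> \<in> U \<rightarrow> {0..k}"
  shows "int (card {\<tau>. \<tau> permutes U \<and> (\<forall>d\<in>U. Suc (snd (\<tau> d)) = Suc (snd d))})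
         * (\<Sum>\<pi> | \<pi> permutes {1..k}. sign \<pi> * (\<Prod>d\<in>U. if \<phi> d = 0 then c d else a (\<pi> (\<phi> d))))
       = vandermonde_sum k a
         * (\<Sum>\<sigma> | \<sigma> permutes {1..k}. sign \<sigma> * int (card {\<rho>. \<rho> permutes U \<and> (\<forall>d\<in>U. Suc (snd (\<rho> d)) = \<sigma> (\<phi> d))}))"
    (is "int ?\<kappa> * ?S = _ * ?T")
proof -
  let ?P = "{\<sigma>. \<sigma> permutes {1..k}}"
  define e where "e j = card {d \<in> U. \<phi> d = j}" for j
  define N where "N \<sigma> = {\<rho>. \<rho> permutes U \<and> (\<forall>d\<in>U. Suc (snd (\<rho> d)) = \<sigma> (\<phi> d))}" for \<sigma> :: "nat \<Rightarrow> nat"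
  have finU: "finite U" by (simp add: U_def)
  have S: "?S = (\<Prod>d | d \<in> U \<and> \<phi> d = 0. c d)
      * (\<Sum>\<pi>\<in>?P. sign \<pi> * (\<Prod>j\<in>{1..k}. a (\<pi> j) ^ e j))"
    using prod_fibres[OF finU \<phi>, of c "\<lambda>j. a (_ j)"]
    by (simp add: e_def sum_distrib_left mult_ac)
  have N_fib: "e j = \<sigma> j - 1" if "\<sigma> \<in> ?P" "\<rho> \<in> N \<sigma>" "j \<in> {1..k}" for \<sigma> \<rho> j
    using that card_fibre_if_rows_match[of \<sigma> k \<rho> \<phi> j] by (simp add: e_def N_def U_def)
  show ?thesis
  proof (cases "inj_on e {1..k}")
    \<comment> \<open>Two equal exponents make both sides zero: the left one is a determinant with
      equal rows, and on the right any \<open>\<rho>\<close> would force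
      \<open>\<sigma> p - 1 = \<sigma> q - 1\<close>.\<close>
    case False
    then obtain p q where pq: "p \<in> {1..k}" "q \<in> {1..k}" "p \<noteq> q" "e p = e q"
      by (auto simp: inj_on_def)
    have "(\<Sum>\<pi>\<in>?P. sign \<pi> * (\<Prod>j\<in>{1..k}. a (\<pi> j) ^ e j)) = 0"
      by (rule alternating_sum_eq_rows[where h = "\<lambda>j i. a i ^ e j" and p = p and q = q])
        (use pq in auto)
    then have "?S = 0" using S by simp
    moreover have "N \<sigma> = {}" if \<sigma>: "\<sigma> \<in> ?P" for \<sigma>
    proof (rule ccontr)
      assume "N \<sigma> \<noteq> {}"
      then obtain \<rho> where "\<rho> \<in> N \<sigma>" by blast
      from N_fib[OF \<sigma> this] pq have "\<sigma> p - 1 = \<sigma> q - 1" by metis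
      moreover have "\<sigma> p \<in> {1..k}" "\<sigma> q \<in> {1..k}" "\<sigma> p \<noteq> \<sigma> q"
        using pq \<sigma> permutes_in_image[of \<sigma> "{1..k}"] permutes_inj[of \<sigma> "{1..k}"] by (auto dest: injD)
      ultimately show False by auto
    qed
    then have "?T = 0" unfolding N_def[symmetric] by simp
    ultimately show ?thesis by simp
  next
    \<comment> \<open>Distinct exponents determine a single \<open>\<sigma>\<^sub>0\<close>; it
      alone contributes on the right, with \<open>\<kappa>\<close> permutations.\<close>
    case True
    obtain \<sigma>\<^sub>0 where \<sigma>\<^sub>0: "\<sigma>\<^sub>0 permutes {1..k}"
      and fib: "\<And>j. j \<in> {1..k} \<Longrightarrow> e j = \<sigma>\<^sub>0 j - 1" and nz: "\<And>d. d \<in> U \<Longrightarrow> \<phi> d \<noteq> 0"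
      using distinct_fibre_cards[OF \<phi>[unfolded U_def] True[unfolded e_def U_def], folded U_def, folded e_def]
      by blast
    have "{d. d \<in> U \<and> \<phi> d = 0} = {}" using nz by blast
    moreover have "(\<Sum>\<pi>\<in>?P. sign \<pi> * (\<Prod>j\<in>{1..k}. a (\<pi> j) ^ e j)) = sign \<sigma>\<^sub>0 * vandermonde_sum k a"
      unfolding alternating_sum_permuted_exponents[OF \<sigma>\<^sub>0, symmetric] using fib by simp
    ultimately have S': "?S = sign \<sigma>\<^sub>0 * vandermonde_sum k a"
      unfolding S by (simp only: prod.empty mult_1)
    have \<phi>': "\<phi> \<in> U \<rightarrow> {1..k}"
    proof
      fix d assume d: "d \<in> U"
      then have "\<phi> d \<in> {0..k}" using \<phi> by blast
      then show "\<phi> d \<in> {1..k}" using nz[OF d] by simp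
    qed
    obtain \<rho>\<^sub>0 where \<rho>\<^sub>0: "\<rho>\<^sub>0 permutes U" "\<forall>d\<in>U. Suc (snd (\<rho>\<^sub>0 d)) = \<sigma>\<^sub>0 (\<phi> d)"
      using ex_rows_match[OF \<sigma>\<^sub>0 \<phi>'[unfolded U_def], folded U_def, folded e_def, OF fib] by blast
    have "card (N \<sigma>\<^sub>0) = ?\<kappa>"
      unfolding N_def by (rule card_permutations_prescribed[OF \<rho>\<^sub>0])
    moreover have "N \<sigma> = {}" if \<sigma>: "\<sigma> \<in> ?P" "\<sigma> \<noteq> \<sigma>\<^sub>0" for \<sigma>
    proof (rule ccontr)
      assume "N \<sigma> \<noteq> {}"
      then obtain \<rho> where \<rho>: "\<rho> \<in> N \<sigma>" by blast
      have "\<sigma> j = \<sigma>\<^sub>0 j" for j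
      proof (cases "j \<in> {1..k}")
        case True
        then have "\<sigma> j - 1 = \<sigma>\<^sub>0 j - 1" using N_fib[OF \<sigma>(1) \<rho> True] fib[OF True] by simp
        moreover have "\<sigma> j \<in> {1..k}" "\<sigma>\<^sub>0 j \<in> {1..k}"
          using True \<sigma>(1) permutes_in_image[OF \<sigma>\<^sub>0, of j] permutes_in_image[of \<sigma> "{1..k}" j] by auto
        ultimately show ?thesis by auto
      next
        case False
        then show ?thesis using \<sigma>(1) permutes_not_in[OF \<sigma>\<^sub>0 False] permutes_not_in[of \<sigma> "{1..k}" j] by simp
      qed
      then show False using \<sigma>(2) by auto
    qed
    ultimately have "?T = (\<Sum>\<sigma>\<in>?P. if \<sigma> = \<sigma>\<^sub>0 then sign \<sigma>\<^sub>0 * int ?\<kappa> else 0)"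
      unfolding N_def[symmetric] by (intro sum.cong) auto
    also have "\<dots> = sign \<sigma>\<^sub>0 * int ?\<kappa>"
      using \<sigma>\<^sub>0 finite_permutations[of "{1..k}"] by simp
    finally show ?thesis using S' by simp
  qed
qed

section \<open>Nonvanishing of the alternating sum\<close>

text \<open>If every permutation failed, the alternating sum of the products would be 0. But
  \<open>\<kappa>\<close> times that sum is \<open>vandermonde_sum k a * T\<close>, and both of
  these factors are nonzero.\<close>

lemma exists_permutation_avoiding:
  fixes a :: "nat \<Rightarrow> int" and c :: "nat \<times> nat \<Rightarrow> int" and pos :: "nat \<times> nat \<Rightarrow> nat"
  assumes inj: "inj_on a {1..k}"
    and pos: "\<And>s. s \<in> upper_class k \<Longrightarrow> fst s \<le> pos s \<and> pos s \<le> snd s"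
  shows "\<exists>\<pi>. \<pi> permutes {1..k} \<and> (\<forall>s\<in>upper_class k. (\<Sum>j=1..pos s. a (\<pi> j)) \<noteq> c s)"
proof (rule ccontr)
  assume contra: "\<not> ?thesis"
  define U where "U = upper_class k"
  define P where "P = {\<sigma>. \<sigma> permutes {1..k}}"
  define PU where "PU = {\<rho>. \<rho> permutes U}"
  define E where "E = PiE U (\<lambda>d. {0..pos d})"
  \<comment> \<open>The number of permutations preserving the rows,
    \<open>0! * 1! * ... * (k - 1)!\<close>; it plays the part of the factorials produced by
    differentiating monomials.\<close>
  define \<kappa> where "\<kappa> = card {\<tau>. \<tau> permutes U \<and> (\<forall>d\<in>U. Suc (snd (\<tau> d)) = Suc (snd d))}"
  define N where "N \<sigma> \<phi> = card {\<rho>. \<rho> permutes U \<and> (\<forall>d\<in>U. Suc (snd (\<rho> d)) = \<sigma> (\<phi> d))}"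
    for \<sigma> :: "nat \<Rightarrow> nat" and \<phi> :: "nat \<times> nat \<Rightarrow> nat"
  define G where "G \<pi> \<phi> = (\<Prod>d\<in>U. if \<phi> d = 0 then - c d else a (\<pi> (\<phi> d)))"
    for \<pi> :: "nat \<Rightarrow> nat" and \<phi> :: "nat \<times> nat \<Rightarrow> nat"
  define ind where "ind j d = (if j \<le> pos d then 1 else 0 :: int)" for j d
  \<comment> \<open>The mixed finite difference at the origin of the Vandermonde polynomial, along
    the 0-1 vectors \<open>(ind 1 d, ..., ind k d)\<close> for \<open>d\<close> in
    \<open>U\<close>.\<close>
  define T where "T = (\<Sum>R\<in>Pow U. (-1) ^ card (U - R) * vandermonde_sum k (\<lambda>j. \<Sum>d\<in>R. ind j d))"
  have finU: "finite U" by (simp add: U_def)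
  have finPU: "finite PU" unfolding PU_def using finU by (rule finite_permutations)
  have finE: "finite E" unfolding E_def using finU by (intro finite_PiE) auto

  have expansion_zero: "(\<Sum>\<phi>\<in>E. G \<pi> \<phi>) = 0" if \<pi>: "\<pi> \<in> P" for \<pi>
  proof -
    obtain s where s: "s \<in> U" "(\<Sum>j=1..pos s. a (\<pi> j)) = c s"
      using contra \<pi> unfolding U_def P_def by blast
    have "(\<Sum>\<phi>\<in>E. G \<pi> \<phi>) = (\<Prod>d\<in>U. \<Sum>j\<in>{0..pos d}. if j = 0 then - c d else a (\<pi> j))"
      unfolding E_def G_def using finU by (intro prod_sum_PiE[symmetric]) auto
    also have "\<dots> = (\<Prod>d\<in>U. (\<Sum>j=1..pos d. a (\<pi> j)) - c d)"
    proof (rule prod.cong)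
      fix d
      have "(\<Sum>j\<in>{1..pos d}. if j = 0 then - c d else a (\<pi> j)) = (\<Sum>j=1..pos d. a (\<pi> j))"
        by (rule sum.cong) auto
      then show "(\<Sum>j\<in>{0..pos d}. if j = 0 then - c d else a (\<pi> j)) = (\<Sum>j=1..pos d. a (\<pi> j)) - c d"
        by (simp add: sum.atLeast_Suc_atMost)
    qed simp
    also have "\<dots> = 0" using s finU by (intro prod_zero) auto
    finally show ?thesis .
  qed

  \<comment> \<open>Pairs \<open>(\<phi>, \<rho>)\<close> are counted by \<open>\<rho>\<close>,
    which determines \<open>\<phi>\<close>; the result lies in \<open>E\<close> exactly when all the
    indicators are 1.\<close>
  have sum_N: "(\<Sum>\<phi>\<in>E. int (N \<sigma> \<phi>)) = (\<Sum>\<rho>\<in>PU. \<Prod>d\<in>U. ind (inv \<sigma> (Suc (snd (\<rho> d)))) d)"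
    if "\<sigma> \<in> P" for \<sigma>
  proof -
    have \<sigma>: "\<sigma> permutes {1..k}" using that by (simp add: P_def)
    have \<sigma>_eq: "m = \<sigma> j \<longleftrightarrow> j = inv \<sigma> m" for m j
      using permutes_inverses[OF \<sigma>] by metis
    have "(\<Sum>\<phi>\<in>E. int (N \<sigma> \<phi>))
        = (\<Sum>\<phi>\<in>E. \<Sum>\<rho>\<in>PU. if \<forall>d\<in>U. Suc (snd (\<rho> d)) = \<sigma> (\<phi> d) then 1 else 0)"
      using finPU by (intro sum.cong refl) (simp add: N_def PU_def flip: sum.inter_filter)
    also have "\<dots> = (\<Sum>\<rho>\<in>PU. \<Sum>\<phi>\<in>E. if \<forall>d\<in>U. Suc (snd (\<rho> d)) = \<sigma> (\<phi> d) then 1 else 0)"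
      by (rule sum.swap)
    also have "\<dots> = (\<Sum>\<rho>\<in>PU. \<Prod>d\<in>U. ind (inv \<sigma> (Suc (snd (\<rho> d)))) d)"
    proof (rule sum.cong)
      fix \<rho> assume "\<rho> \<in> PU"
      define \<phi>\<^sub>0 where "\<phi>\<^sub>0 = restrict (\<lambda>d. inv \<sigma> (Suc (snd (\<rho> d)))) U"
      have uniq: "(\<forall>d\<in>U. Suc (snd (\<rho> d)) = \<sigma> (\<phi> d)) \<longleftrightarrow> \<phi> = \<phi>\<^sub>0" if "\<phi> \<in> E" for \<phi>
        using that unfolding \<sigma>_eq \<phi>\<^sub>0_def E_def
        by (auto simp: fun_eq_iff PiE_def extensional_def)
      have "(\<Sum>\<phi>\<in>E. if \<forall>d\<in>U. Suc (snd (\<rho> d)) = \<sigma> (\<phi> d) then 1 else 0 :: int)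
          = (\<Sum>\<phi>\<in>E. if \<phi> = \<phi>\<^sub>0 then 1 else 0)"
        by (rule sum.cong) (simp_all add: uniq)
      also have "\<dots> = (if \<phi>\<^sub>0 \<in> E then 1 else 0)" using finE by simp
      also have "\<phi>\<^sub>0 \<in> E \<longleftrightarrow> (\<forall>d\<in>U. inv \<sigma> (Suc (snd (\<rho> d))) \<le> pos d)"
        by (auto simp: \<phi>\<^sub>0_def E_def PiE_def Pi_def)
      also have "(if \<forall>d\<in>U. inv \<sigma> (Suc (snd (\<rho> d))) \<le> pos d then 1 else 0)
          = (\<Prod>d\<in>U. ind (inv \<sigma> (Suc (snd (\<rho> d)))) d)"
      proof (cases "\<forall>d\<in>U. inv \<sigma> (Suc (snd (\<rho> d))) \<le> pos d")
        case True
        then show ?thesis by (simp add: ind_def)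
      next
        case False
        then have "(\<Prod>d\<in>U. ind (inv \<sigma> (Suc (snd (\<rho> d)))) d) = 0"
          using finU by (intro prod_zero) (auto simp: ind_def)
        then show ?thesis using False by simp
      qed
      finally show "(\<Sum>\<phi>\<in>E. if \<forall>d\<in>U. Suc (snd (\<rho> d)) = \<sigma> (\<phi> d) then 1 else 0 :: int)
          = (\<Prod>d\<in>U. ind (inv \<sigma> (Suc (snd (\<rho> d)))) d)" .
    qed simp
    finally show ?thesis .
  qed

  \<comment> \<open>First evaluation of \<open>T\<close>: the Leibniz sum for the Vandermonde
    determinant, with Ryser's formula applied for each \<open>\<sigma>\<close>.\<close>
  have T_alt: "T = (\<Sum>\<sigma>\<in>P. sign \<sigma> * (\<Sum>\<phi>\<in>E. int (N \<sigma> \<phi>)))"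
  proof -
    have "T = (\<Sum>R\<in>Pow U. \<Sum>\<sigma>\<in>P. sign \<sigma> * ((-1) ^ card (U - R) * (\<Prod>s\<in>U. \<Sum>d\<in>R. ind (inv \<sigma> (Suc (snd s))) d)))"
      unfolding T_def vandermonde_sum_conv_upper_class P_def U_def
      by (simp add: sum_distrib_left mult_ac)
    also have "\<dots> = (\<Sum>\<sigma>\<in>P. sign \<sigma> * (\<Sum>R\<in>Pow U. (-1) ^ card (U - R) * (\<Prod>s\<in>U. \<Sum>d\<in>R. ind (inv \<sigma> (Suc (snd s))) d)))"
      by (subst sum.swap) (simp add: sum_distrib_left)
    also have "\<dots> = (\<Sum>\<sigma>\<in>P. sign \<sigma> * (\<Sum>\<phi>\<in>E. int (N \<sigma> \<phi>)))"
      using ryser_permanent[OF finU] sum_N by (intro sum.cong refl) (simp add: PU_def)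
    finally show ?thesis .
  qed

  have "vandermonde_sum k a * T = 0"
  proof -
    have "vandermonde_sum k a * T = (\<Sum>\<phi>\<in>E. vandermonde_sum k a * (\<Sum>\<sigma>\<in>P. sign \<sigma> * int (N \<sigma> \<phi>)))"
      unfolding T_alt sum_distrib_left by (rule sum.swap)
    also have "\<dots> = (\<Sum>\<phi>\<in>E. int \<kappa> * (\<Sum>\<pi>\<in>P. sign \<pi> * G \<pi> \<phi>))"
    proof (rule sum.cong)
      fix \<phi> assume \<phi>: "\<phi> \<in> E"
      have "\<phi> \<in> U \<rightarrow> {0..k}"
      proof
        fix d assume d: "d \<in> U"
        have "\<phi> d \<le> pos d" using \<phi> d by (auto simp: E_def)
        also have "pos d \<le> k" using pos[of d] d by (auto simp: U_def upper_class_def)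
        finally show "\<phi> d \<in> {0..k}" by simp
      qed
      then show "vandermonde_sum k a * (\<Sum>\<sigma>\<in>P. sign \<sigma> * int (N \<sigma> \<phi>))
          = int \<kappa> * (\<Sum>\<pi>\<in>P. sign \<pi> * G \<pi> \<phi>)"
        unfolding N_def \<kappa>_def G_def U_def P_def by (rule alternating_sum_monomial[symmetric])
    qed simp
    also have "\<dots> = int \<kappa> * (\<Sum>\<pi>\<in>P. sign \<pi> * (\<Sum>\<phi>\<in>E. G \<pi> \<phi>))"
      unfolding sum_distrib_left by (rule sum.swap)
    also have "\<dots> = 0" using expansion_zero by simp
    finally show ?thesis .
  qed
  moreover have "vandermonde_sum k a \<noteq> 0"
  proof -
    have "a (snd s + 1) \<noteq> a (fst s)" if "s \<in> upper_class k" for s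
    proof -
      have "snd s + 1 \<in> {1..k}" "fst s \<in> {1..k}" "fst s \<noteq> snd s + 1"
        using that by (auto simp: upper_class_def)
      then show ?thesis using inj_onD[OF inj] by metis
    qed
    then show ?thesis by (simp add: vandermonde_sum_eq_prod)
  qed
  moreover have "T \<noteq> 0"
  proof -
    \<comment> \<open>Second evaluation of \<open>T\<close>, from the product form: up to sign it is
      the permanent of the incidence matrix \<open>edge\<close>. All terms are nonnegative, and the
      identity contributes 1 since \<open>pos d\<close> lies in \<open>d\<close>.\<close>
    define edge where "edge s d = (if fst s \<le> pos d \<and> pos d \<le> snd s then 1 else 0 :: int)" for s d
    have "ind (snd s + 1) d - ind (fst s) d = - edge s d" if "s \<in> U" for s d
      using that by (auto simp: ind_def edge_def U_def upper_class_def)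
    then have "T = (\<Sum>R\<in>Pow U. (-1) ^ card (U - R) * (\<Prod>s\<in>U. \<Sum>d\<in>R. - edge s d))"
      unfolding T_def vandermonde_sum_eq_prod U_def[symmetric]
      by (intro sum.cong refl arg_cong2[where f = "(*)"] prod.cong) (simp flip: sum_subtractf)
    also have "\<dots> = (\<Sum>\<rho>\<in>PU. \<Prod>d\<in>U. - edge (\<rho> d) d)"
      unfolding PU_def by (rule ryser_permanent[OF finU])
    also have "\<dots> = (-1) ^ card U * (\<Sum>\<rho>\<in>PU. \<Prod>d\<in>U. edge (\<rho> d) d)"
      by (simp add: prod_uminus sum_distrib_left)
    finally have "T = (-1) ^ card U * (\<Sum>\<rho>\<in>PU. \<Prod>d\<in>U. edge (\<rho> d) d)" .
    moreover have "(\<Sum>\<rho>\<in>PU. \<Prod>d\<in>U. edge (\<rho> d) d) \<ge> (\<Prod>d\<in>U. edge (id d) d)"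
      using finPU permutes_id[of U]
      by (intro member_le_sum[of id PU "\<lambda>\<rho>. \<Prod>d\<in>U. edge (\<rho> d) d"])
        (auto simp: PU_def edge_def intro!: prod_nonneg)
    moreover have "(\<Prod>d\<in>U. edge (id d) d) = 1"
      using pos by (intro prod.neutral) (auto simp: edge_def U_def)
    ultimately show ?thesis by auto
  qed
  ultimately show False by simp
qed

lemma matching_sequence_imp_admissible:
  assumes "matching_sequence k b"
  shows "admissible k b"
  unfolding admissible_def
proof (intro allI impI)
  fix a :: "nat \<Rightarrow> int" and M :: "nat \<Rightarrow> int set"
  assume inj: "inj_on a {1..k}" and M: "\<forall>i\<in>{1..k-1}. finite (M i) \<and> card (M i) = b i"
  obtain f where f: "inj_on f (lower_class k b)"
    and edge: "\<And>d. d \<in> lower_class k b \<Longrightarrow> f d \<in> upper_class k \<and> B_edge (f d) d"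
    using assms by (auto simp: matching_sequence_def)
  have "\<exists>h. bij_betw h {1..b i} (M i)" if "i \<in> {1..k-1}" for i
    using M that ex_bij_betw_nat_finite_1[of "M i"] by auto
  then obtain \<mu> where \<mu>: "\<And>i. i \<in> {1..k-1} \<Longrightarrow> bij_betw (\<mu> i) {1..b i} (M i)" by metis
  define g where "g = inv_into (lower_class k b) f"
  have g: "g (f d) = d" if "d \<in> lower_class k b" for d
    using that f by (simp add: g_def)
  \<comment> \<open>The interval matched to \<open>(i, t)\<close> receives position \<open>i\<close>
    and the \<open>t\<close>-th element of \<open>M i\<close>. Unmatched intervals receive a
    harmless extra condition: their left end and the value 0.\<close>
  define pos where "pos s = (if s \<in> f ` lower_class k b then fst (g s) else fst s)" for s
  define c where "c s = (if s \<in> f ` lower_class k b then \<mu> (fst (g s)) (snd (g s)) else 0)" for s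
  have "fst s \<le> pos s \<and> pos s \<le> snd s" if "s \<in> upper_class k" for s
    using that edge by (auto simp: pos_def g B_edge_def upper_class_def)
  from exists_permutation_avoiding[OF inj this, of c]
  obtain \<pi> where \<pi>: "\<pi> permutes {1..k}"
    and avoid: "\<And>s. s \<in> upper_class k \<Longrightarrow> (\<Sum>j=1..pos s. a (\<pi> j)) \<noteq> c s" by blast
  have "(\<Sum>j=1..i. a (\<pi> j)) \<notin> M i" if i: "i \<in> {1..k-1}" for i
  proof
    assume "(\<Sum>j=1..i. a (\<pi> j)) \<in> M i"
    then obtain t where t: "t \<in> {1..b i}" "\<mu> i t = (\<Sum>j=1..i. a (\<pi> j))"
      using bij_betw_imp_surj_on[OF \<mu>[OF i]] by (metis imageE)
    have d: "(i, t) \<in> lower_class k b" using i t by (auto simp: lower_class_def)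
    have "pos (f (i, t)) = i" "c (f (i, t)) = \<mu> i t"
      using d g[OF d] by (auto simp: pos_def c_def)
    then show False using avoid[of "f (i, t)"] edge[OF d] t by simp
  qed
  then show "\<exists>\<pi>. \<pi> permutes {1..k} \<and> (\<forall>i\<in>{1..k-1}. (\<Sum>j=1..i. a (\<pi> j)) \<notin> M i)"
    using \<pi> by blast
qed

theorem mainTheorem5:
  fixes k :: nat and b :: "nat \<Rightarrow> nat"
  assumes "k \<ge> 2"
  shows "admissible k b \<longleftrightarrow> matching_sequence k b"
  using admissible_imp_matching_sequence matching_sequence_imp_admissible by blast

end
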